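(* Let $n\ge1$ be an integer. For each real $s>-n-1$ there exist constants $0<c_s<C_s<+\infty$ such that $$c_s\le(p+1)^{s+1}(q+1)^{s+1}c_{pq}(s)\le C_s\qquad\text{for all integers }p,q\ge0.$$
   Context: Notation: $(\nu)_k=\nu(\nu+1)\cdots(\nu+k-1)$, ${}_2F_1$ is the Gauss hypergeometric function. For integers $p,q\ge0$, $$S_{pq}(t)=\frac{{}_2F_1(p,q;p+q+n;t)}{{}_2F_1(p,q;p+q+n;1)}=\frac{(n)_p(n)_q}{(n)_{p+q}}\,{}_2F_1(p,q;p+q+n;t),$$ and for $s>-1$ $$c_{pq}(s)=\frac{(s+1)_n}{\Gamma(n)}\int_0^1t^{p+q+n-1}(1-t)^sS_{pq}(t)^2\,dt.$$ For each $p,q$, the function $c_{pq}$ extends holomorphically to the half-plane $\operatorname{Re}s>-n-1$, and for $-n-1<s\le-1$ the symbol $c_{pq}(s)$ denotes the value of this analytic continuation. *)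

theory Defs
  imports "HOL-Complex_Analysis.Complex_Analysis"
begin

definition gauss_2F1 :: "real \<Rightarrow> real \<Rightarrow> real \<Rightarrow> real \<Rightarrow> real" where
  "gauss_2F1 a b c t = eval_fps (fps_hypergeo [a, b] [c] 1) t"

lemma gauss_2F1_series:
  "gauss_2F1 a b c t =
     (\<Sum>k. pochhammer a k * pochhammer b k / (pochhammer c k * fact k) * t ^ k)"
  by (simp add: gauss_2F1_def eval_fps_def)

(* At t = 1 the series still converges for n \<ge> 1, since (p + q + n) - p - q = n > 0. *)
definition S_pq :: "nat \<Rightarrow> nat \<Rightarrow> nat \<Rightarrow> real \<Rightarrow> real" where
  "S_pq n p q t =
     gauss_2F1 (real p) (real q) (real (p + q + n)) t /
     gauss_2F1 (real p) (real q) (real (p + q + n)) 1"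

(* Meant for n \<ge> 1 (so that the natural-number subtraction is exact) and s > -1. *)
definition c_integral :: "nat \<Rightarrow> nat \<Rightarrow> nat \<Rightarrow> real \<Rightarrow> real" where
  "c_integral n p q s =
     pochhammer (s + 1) n / Gamma (real n) *
     integral {0..1} (\<lambda>t. t ^ (p + q + n - 1) * (1 - t) powr s * (S_pq n p q t)\<^sup>2)"

definition c_extension :: "nat \<Rightarrow> nat \<Rightarrow> nat \<Rightarrow> (complex \<Rightarrow> complex) \<Rightarrow> bool" where
  "c_extension n p q g \<longleftrightarrow>
     g holomorphic_on {z. Re z > - real n - 1} \<and>
     (\<forall>s::real. s > -1 \<longrightarrow> g (complex_of_real s) = complex_of_real (c_integral n p q s))"

(* By the identity theorem all extensions g agree on the half-plane. Since v ranges over the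
   reals, the description below denotes only if the extension exists and is real at s. *)
definition c_pq :: "nat \<Rightarrow> nat \<Rightarrow> nat \<Rightarrow> real \<Rightarrow> real" where
  "c_pq n p q s =
     (if s > -1 then c_integral n p q s
      else (THE v. \<exists>g. c_extension n p q g \<and> g (complex_of_real s) = complex_of_real v))"

end

theory Submission
  imports Defs
begin

text \<open>
Let \<open>b\<^sub>k \<ge> 0\<close> be the Taylor coefficients of \<open>S_pq\<close> at \<open>0\<close> and \<open>A\<^sub>k\<close> those of its square, the
convolution of \<open>b\<close> with itself. Termwise integration with the Beta function gives, for \<open>s > -1\<close>,

  \<open>c_pq(s) = \<Sum>\<^sub>k A\<^sub>k (n)\<^sub>m / (n + 1 + s)\<^sub>m\<close> with \<open>m = p + q + k\<close>,

where \<open>(x)\<^sub>m\<close> denotes the Pochhammer symbol.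
The prefactor \<open>(s + 1)\<^sub>n\<close> has cancelled all poles of the Beta function with real part above \<open>-n - 1\<close>,
and the right-hand side is a locally uniformly convergent series of holomorphic functions on the whole
half-plane \<open>Re s > -n - 1\<close>. By the identity theorem it is the analytic continuation
(\<open>c_pq_eq_c_series\<close>), so that only a series with positive terms has to be estimated.

The weights \<open>(n)\<^sub>m / (n + 1 + s)\<^sub>m\<close> are comparable to \<open>(m + 1) powr (- s - 1)\<close>. Everything therefore
concerns the moments of order \<open>a = - s - 1 < n\<close> of the variable \<open>p + q + k + 1\<close> under the probability
weights \<open>A\<^sub>k\<close>; the claim is that they are comparable to \<open>((p + 1) (q + 1)) powr a\<close>. The decisive fact is
that the analogous sum with \<open>b\<^sub>k\<close> in place of \<open>A\<^sub>k\<close> has a closed product form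
(\<open>S_coeff_moment\<close>): by Gauss's summation theorem,

  \<open>\<Sum>\<^sub>k b\<^sub>k (n)\<^sub>m / (\<nu>)\<^sub>m = (n)\<^sub>p / (\<nu>)\<^sub>p * (n)\<^sub>q / (\<nu>)\<^sub>q\<close> with \<open>m = p + q + k\<close>.

The upper bound for \<open>A = b * b\<close> follows because \<open>(p + q + i + j + 1) powr a\<close> is bounded by a constant
times the sum of \<open>(p + q + i + 1) powr a\<close> and \<open>(p + q + j + 1) powr a\<close> (\<open>power_moment_upper\<close>). For the
lower bound, a probability distribution cannot have small normalized moments of two orders of opposite
sign; so the upper bound at a small order of the opposite sign yields the lower bound at order \<open>a\<close>
(\<open>power_moment_lower\<close>).
\<close>


section \<open>Growth of quotients of Pochhammer symbols\<close>

definition poch_ratio :: "'a::field_char_0 \<Rightarrow> 'a \<Rightarrow> nat \<Rightarrow> 'a" where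
  "poch_ratio x y m = pochhammer x m / pochhammer y m"

lemma poch_ratio_pos:
  fixes x y :: real
  assumes "x > 0" "y > 0"
  shows "poch_ratio x y m > 0"
  using assms by (simp add: poch_ratio_def pochhammer_pos)

lemma poch_ratio_swap: "poch_ratio y x m = inverse (poch_ratio x y m)"
  by (simp add: poch_ratio_def)

text \<open>Gauss's limit formula gives \<open>pochhammer x m \<sim> fact (m - 1) * m powr x / Gamma x\<close>, so the quotient
below times \<open>m powr (y - x)\<close> converges, and convergent sequences are bounded. Replacing \<open>m\<close> by
\<open>m + 1\<close> in the power does not change the limit and makes the bound meaningful at \<open>m = 0\<close>.\<close>

lemma poch_ratio_upper:
  fixes x y :: real
  assumes x: "x > 0" and y: "y > 0"
  shows "\<exists>C>0. \<forall>m. poch_ratio x y m \<le> C * (real m + 1) powr (x - y)"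
proof -
  have "(\<lambda>m. Gamma_series' y m / Gamma_series' x m * ((real m + 1) / real m) powr (y - x))
          \<longlonglongrightarrow> Gamma y / Gamma x * 1"
  proof (intro tendsto_mult tendsto_divide Gamma_series'_LIMSEQ)
    show "Gamma x \<noteq> 0" using x Gamma_real_pos[of x] by linarith
    show "(\<lambda>m. ((real m + 1) / real m) powr (y - x)) \<longlonglongrightarrow> 1"
      by real_asymp
  qed
  moreover have "\<forall>\<^sub>F m in sequentially.
      Gamma_series' y m / Gamma_series' x m * ((real m + 1) / real m) powr (y - x)
        = poch_ratio x y m * (real m + 1) powr (y - x)"
    using eventually_gt_at_top[of "0::nat"]
  proof eventually_elim
    case (elim m)
    have "pochhammer x m > 0" "pochhammer y m > 0"
      using x y by (auto intro: pochhammer_pos)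
    then have "Gamma_series' y m / Gamma_series' x m = exp ((y - x) * ln (real m)) * poch_ratio x y m"
      by (simp add: Gamma_series'_def poch_ratio_def left_diff_distrib exp_diff)
    moreover have "((real m + 1) / real m) powr (y - x)
        = (real m + 1) powr (y - x) / exp ((y - x) * ln (real m))"
      using elim by (simp add: powr_divide powr_def[of "real m"])
    ultimately show ?case by simp
  qed
  ultimately have "(\<lambda>m. poch_ratio x y m * (real m + 1) powr (y - x)) \<longlonglongrightarrow> Gamma y / Gamma x * 1"
    by (rule Lim_transform_eventually)
  then have "Bseq (\<lambda>m. poch_ratio x y m * (real m + 1) powr (y - x))"
    by (intro convergent_imp_Bseq convergentI)
  then obtain C where C: "C > 0" "\<And>m. norm (poch_ratio x y m * (real m + 1) powr (y - x)) \<le> C"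
    by (rule BseqE) blast
  have "poch_ratio x y m \<le> C * (real m + 1) powr (x - y)" for m
  proof -
    have "poch_ratio x y m * (real m + 1) powr (y - x) * (real m + 1) powr (x - y)
            \<le> C * (real m + 1) powr (x - y)"
      using C(2)[of m] by (intro mult_right_mono) auto
    then show ?thesis
      by (simp add: mult.assoc flip: powr_add)
  qed
  with C(1) show ?thesis by blast
qed

section \<open>Gauss's summation theorem for natural upper parameters\<close>

lemma pochhammer_real_nonneg: "pochhammer (real m) k \<ge> 0"
  by (simp add: pochhammer_of_nat)

text \<open>A telescoping (Wilf--Zeilberger) identity. At \<open>K = \<infinity>\<close>, where the boundary term vanishes, it becomes
the contiguous relation \<open>(c - a - b - 1) F(a + 1, b; c; 1) = (c - a - 1) F(a, b; c; 1)\<close>, which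
drives the induction in the summation theorem below.\<close>

lemma hypergeo_partial_sum_contiguous:
  fixes a b c :: real
  assumes c: "c > 0"
  defines "t \<equiv> \<lambda>a k. pochhammer a k * pochhammer b k / (pochhammer c k * fact k)"
  shows "(c - a - b - 1) * (\<Sum>k\<le>K. t (a + 1) k) + (b + real K) * t (a + 1) K
           = (c - a - 1) * (\<Sum>k\<le>K. t a k)"
proof (induction K)
  case 0
  then show ?case by (simp add: t_def)
next
  case (Suc K)
  have pc: "pochhammer c K > 0" "c + real K > 0"
    using c by (auto intro: pochhammer_pos)
  define u where "u = t (a + 1) K * (b + real K) / ((c + real K) * (real K + 1))"
  have 1: "t (a + 1) (Suc K) = u * (a + 1 + real K)"
    using pc by (simp add: t_def u_def pochhammer_Suc field_simps)
  have 2: "t a (Suc K) = u * a"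
    using pc by (simp add: t_def u_def pochhammer_Suc[of b] pochhammer_Suc[of c] pochhammer_rec[of a] field_simps)
  have 3: "(b + real K) * t (a + 1) K = u * ((c + real K) * (real K + 1))"
    using pc by (simp add: u_def)
  have 4: "(c - a - b - 1) * (u * (a + 1 + real K)) + (b + real (Suc K)) * (u * (a + 1 + real K))
            = (c - a - 1) * (u * a) + u * ((c + real K) * (real K + 1))"
    by (simp add: algebra_simps)
  show ?case
    using Suc.IH 4 unfolding sum.atMost_Suc 1 2 3 distrib_left by linarith
qed

text \<open>A positive limit would make the series dominate the harmonic series. This lemma disposes of the
boundary term of the telescoping identity, whose convergence is known before its limit.\<close>

lemma tendsto_0_if_summable_of_nat_mult:
  fixes f :: "nat \<Rightarrow> real"
  assumes sf: "summable f" and lim: "(\<lambda>k. real (m + k) * f k) \<longlonglongrightarrow> L"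
    and nn: "\<And>k. f k \<ge> 0"
  shows "L = 0"
proof (rule ccontr)
  assume "L \<noteq> 0"
  moreover have "L \<ge> 0"
    using lim by (rule LIMSEQ_le_const) (auto simp: nn)
  ultimately have L: "L > 0" by simp
  then have "\<forall>\<^sub>F k in sequentially. real (m + k) * f k > L / 2"
    using lim by (intro order_tendstoD) auto
  then have "\<forall>\<^sub>F k in sequentially. norm (inverse (real (k + m))) \<le> 2 / L * f k"
    using eventually_gt_at_top[of "0::nat"]
    by eventually_elim (use L in \<open>auto simp: field_simps\<close>)
  then have "summable (\<lambda>k. inverse (real (k + m)))"
    by (rule summable_comparison_test_ev) (intro summable_mult sf)
  then show False
    using not_summable_harmonic[where 'a = real] summable_iff_shift[of "\<lambda>k. inverse (real k)" m] by simp
qed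

text \<open>Gauss's evaluation of \<open>F(p, q; c; 1)\<close> for natural numbers \<open>p\<close> and \<open>q\<close>, where the Gamma quotient
\<open>\<Gamma>(c) \<Gamma>(c - p - q) / (\<Gamma>(c - p) \<Gamma>(c - q))\<close> is a quotient of Pochhammer symbols in the excess
\<open>\<nu> = c - p - q\<close>. The induction on \<open>p\<close> keeps \<open>c\<close> fixed, so that \<open>\<nu>\<close> must vary with \<open>p\<close>.\<close>

theorem Gauss_hypergeo_sum_nat:
  fixes \<nu> :: real
  assumes "\<nu> > 0"
  shows "(\<lambda>k. pochhammer (real p) k * pochhammer (real q) k /
                (pochhammer (\<nu> + real p + real q) k * fact k))
           sums (pochhammer \<nu> (p + q) / (pochhammer \<nu> p * pochhammer \<nu> q))"
  using assms
proof (induction p arbitrary: \<nu>)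
  case 0
  have "(\<lambda>k. if k = 0 then 1 else 0 :: real) sums 1"
    using sums_single[of 0 "\<lambda>_. 1::real"] by simp
  moreover have "pochhammer (0::real) k * pochhammer (real q) k /
        (pochhammer (\<nu> + 0 + real q) k * fact k) = (if k = 0 then 1 else 0)" for k
    by (cases k) (auto simp: pochhammer_rec)
  ultimately show ?case
    using 0 pochhammer_pos[of \<nu> q] by simp
next
  case (Suc p)
  define c where "c = \<nu> + real (Suc p) + real q"
  define t where "t = (\<lambda>a k. pochhammer a k * pochhammer (real q) k / (pochhammer c k * fact k))"
  define F where "F = pochhammer (\<nu> + 1) (p + q) / (pochhammer (\<nu> + 1) p * pochhammer (\<nu> + 1) q)"
  have c: "c > 0" using Suc.prems by (simp add: c_def)
  have IH: "t (real p) sums F"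
    using Suc.IH[of "\<nu> + 1"] Suc.prems by (simp add: t_def F_def c_def algebra_simps)
  have pos: "t (real m) k \<ge> 0" for m k
    unfolding t_def using c
    by (intro divide_nonneg_nonneg mult_nonneg_nonneg pochhammer_real_nonneg pochhammer_nonneg) auto
  have rec: "\<nu> * (\<Sum>k\<le>K. t (real (Suc p)) k) + real (q + K) * t (real (Suc p)) K
               = (\<nu> + real q) * (\<Sum>k\<le>K. t (real p) k)" for K
    using hypergeo_partial_sum_contiguous[OF c, of "real p" "real q" K]
    by (simp add: t_def c_def algebra_simps)
  \<comment> \<open>All terms are nonnegative, so dropping the boundary term bounds the partial sums.\<close>
  have "(\<Sum>k\<le>K. t (real (Suc p)) k) \<le> (\<nu> + real q) * F / \<nu>" for K
  proof -
    have "\<nu> * (\<Sum>k\<le>K. t (real (Suc p)) k) \<le> (\<nu> + real q) * (\<Sum>k\<le>K. t (real p) k)"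
      unfolding rec[symmetric] using pos[of "Suc p" K] by simp
    also have "\<dots> \<le> (\<nu> + real q) * F"
      using IH Suc.prems pos[of p]
      by (intro mult_left_mono) (auto simp: sums_iff intro!: sum_le_suminf)
    finally show ?thesis
      using Suc.prems by (simp add: field_simps)
  qed
  then have summ: "summable (t (real (Suc p)))"
    using pos by (intro bounded_imp_summable) blast+
  have lim: "(\<lambda>K. \<Sum>k\<le>K. t (real (Suc p)) k) \<longlonglongrightarrow> suminf (t (real (Suc p)))"
    using summ by (simp add: summable_LIMSEQ')
  have limF: "(\<lambda>K. \<Sum>k\<le>K. t (real p) k) \<longlonglongrightarrow> F"
    using IH by (simp add: sums_def_le)
  have "(\<lambda>K. (\<nu> + real q) * (\<Sum>k\<le>K. t (real p) k) - \<nu> * (\<Sum>k\<le>K. t (real (Suc p)) k))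
          \<longlonglongrightarrow> (\<nu> + real q) * F - \<nu> * suminf (t (real (Suc p)))"
    by (intro tendsto_intros lim limF)
  then have "(\<lambda>K. real (q + K) * t (real (Suc p)) K)
               \<longlonglongrightarrow> (\<nu> + real q) * F - \<nu> * suminf (t (real (Suc p)))"
    by (rule Lim_transform_eventually) (auto simp flip: rec)
  from tendsto_0_if_summable_of_nat_mult[OF summ this pos]
  have eq: "\<nu> * suminf (t (real (Suc p))) = (\<nu> + real q) * F" by simp
  have pp: "pochhammer (\<nu> + 1) q > 0" "pochhammer (\<nu> + 1) p > 0" "pochhammer \<nu> q > 0"
    using Suc.prems by (auto intro: pochhammer_pos)
  have "pochhammer \<nu> q * (\<nu> + real q) = \<nu> * pochhammer (\<nu> + 1) q"
    by (metis pochhammer_Suc pochhammer_rec)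
  then have *: "pochhammer (\<nu> + 1) q = pochhammer \<nu> q * (\<nu> + real q) / \<nu>"
    using Suc.prems by (simp add: field_simps)
  have "suminf (t (real (Suc p)))
      = pochhammer \<nu> (Suc p + q) / (pochhammer \<nu> (Suc p) * pochhammer \<nu> q)"
  proof -
    have "suminf (t (real (Suc p))) = (\<nu> + real q) * F / \<nu>"
      using eq Suc.prems by (simp add: field_simps)
    also have "\<dots> = pochhammer (\<nu> + 1) (p + q) / (pochhammer (\<nu> + 1) p * pochhammer \<nu> q)"
      unfolding F_def * using Suc.prems pp by (simp add: add_pos_nonneg less_imp_neq[symmetric])
    also have "\<dots> = pochhammer \<nu> (Suc p + q) / (pochhammer \<nu> (Suc p) * pochhammer \<nu> q)"
      using Suc.prems by (simp add: pochhammer_rec)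
    finally show ?thesis .
  qed
  with summ show ?case
    by (simp add: sums_iff t_def c_def add_ac)
qed

section \<open>Taylor coefficients of the normalized hypergeometric function\<close>

text \<open>The Taylor coefficients of \<open>S_pq n p q\<close>; the leading quotient is the reciprocal of the value at
\<open>1\<close> of the hypergeometric function, by Gauss's theorem.\<close>

definition S_coeff :: "nat \<Rightarrow> nat \<Rightarrow> nat \<Rightarrow> nat \<Rightarrow> real" where
  "S_coeff n p q k =
     pochhammer (real n) p * pochhammer (real n) q / pochhammer (real n) (p + q) *
     (pochhammer (real p) k * pochhammer (real q) k / (pochhammer (real (p + q + n)) k * fact k))"

definition S2_coeff :: "nat \<Rightarrow> nat \<Rightarrow> nat \<Rightarrow> nat \<Rightarrow> real" where
  "S2_coeff n p q k = (\<Sum>i\<le>k. S_coeff n p q i * S_coeff n p q (k - i))"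

lemma S_coeff_nonneg: "S_coeff n p q k \<ge> 0"
  unfolding S_coeff_def
  by (intro mult_nonneg_nonneg divide_nonneg_nonneg pochhammer_real_nonneg fact_ge_zero)

lemma S2_coeff_nonneg: "S2_coeff n p q k \<ge> 0"
  unfolding S2_coeff_def by (intro sum_nonneg mult_nonneg_nonneg S_coeff_nonneg)

text \<open>The sum factorizes because \<open>pochhammer (real n) (p + q + k)\<close> contains the
factor \<open>pochhammer (real (p + q + n)) k\<close>, which cancels the lower parameter of the hypergeometric
series; what remains is again a hypergeometric series at \<open>1\<close>, now with excess \<open>\<nu>\<close>, and Gauss's
theorem evaluates it. All dependence on \<open>p\<close> and \<open>q\<close> in the final estimate originates here.\<close>

lemma S_coeff_moment:
  assumes n: "n \<ge> 1" and \<nu>: "\<nu> > 0"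
  shows "(\<lambda>k. S_coeff n p q k * poch_ratio (real n) \<nu> (p + q + k))
           sums (poch_ratio (real n) \<nu> p * poch_ratio (real n) \<nu> q)"
proof -
  let ?P = "pochhammer (real n)" and ?Q = "pochhammer \<nu>"
  have pos: "?P m > 0" "?Q m > 0" "pochhammer (real (p + q + n)) m > 0" for m
    using assms by (auto intro: pochhammer_pos)
  have "(\<lambda>k. ?P p * ?P q / ?Q (p + q) * (pochhammer (real p) k * pochhammer (real q) k /
                (pochhammer (\<nu> + real p + real q) k * fact k)))
           sums (?P p * ?P q / ?Q (p + q) * (?Q (p + q) / (?Q p * ?Q q)))"
    by (intro sums_mult Gauss_hypergeo_sum_nat \<nu>)
  also have "?P p * ?P q / ?Q (p + q) * (?Q (p + q) / (?Q p * ?Q q))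
               = poch_ratio (real n) \<nu> p * poch_ratio (real n) \<nu> q"
    using pos(2)[of "p + q"] by (simp add: poch_ratio_def)
  also have "(\<lambda>k. ?P p * ?P q / ?Q (p + q) * (pochhammer (real p) k * pochhammer (real q) k /
                (pochhammer (\<nu> + real p + real q) k * fact k)))
             = (\<lambda>k. S_coeff n p q k * poch_ratio (real n) \<nu> (p + q + k))"
  proof
    fix k
    have "?P (p + q + k) = ?P (p + q) * pochhammer (real (p + q + n)) k"
         "?Q (p + q + k) = ?Q (p + q) * pochhammer (\<nu> + real p + real q) k"
      using pochhammer_product'[of "real n" "p + q" k] pochhammer_product'[of \<nu> "p + q" k]
      by (simp_all add: add_ac)
    then show "?P p * ?P q / ?Q (p + q) * (pochhammer (real p) k * pochhammer (real q) k /
                (pochhammer (\<nu> + real p + real q) k * fact k))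
             = S_coeff n p q k * poch_ratio (real n) \<nu> (p + q + k)"
      using pos(1)[of "p + q"] pos(3)[of k] by (simp add: S_coeff_def poch_ratio_def mult_ac)
  qed
  finally show ?thesis .
qed

text \<open>The case \<open>\<nu> = n\<close> of the moment formula: the coefficients form a probability distribution. The same
is true of their convolution \<open>S2_coeff\<close>, as \<open>S2_coeff_sums_1\<close> records.\<close>

lemma S_coeff_sums_1:
  assumes "n \<ge> 1"
  shows "S_coeff n p q sums 1"
proof -
  have "poch_ratio (real n) (real n) m = 1" for m
    using assms pochhammer_pos[of "real n" m] by (simp add: poch_ratio_def)
  then show ?thesis
    using S_coeff_moment[OF assms, of "real n" p q] assms by simp
qed

lemma S_coeff_power_summable:
  assumes "n \<ge> 1" "0 \<le> t" "t \<le> 1"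
  shows "summable (\<lambda>k. S_coeff n p q k * t ^ k)"
  using sums_summable[OF S_coeff_sums_1[OF assms(1), of p q]]
  by (rule summable_comparison_test'[where N = 0])
     (use assms S_coeff_nonneg[of n p q] in \<open>auto simp: abs_mult intro!: mult_left_le power_le_one\<close>)

lemma S_pq_series:
  assumes n: "n \<ge> 1" and t: "0 \<le> t" "t \<le> 1"
  shows "S_pq n p q t = (\<Sum>k. S_coeff n p q k * t ^ k)"
proof -
  let ?P = "pochhammer (real n)"
  let ?h = "\<lambda>k. pochhammer (real p) k * pochhammer (real q) k / (pochhammer (real (p + q + n)) k * fact k)"
  have pos: "?P m > 0" for m using n by (auto intro: pochhammer_pos)
  have "gauss_2F1 (real p) (real q) (real (p + q + n)) 1 = ?P (p + q) / (?P p * ?P q)"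
    using Gauss_hypergeo_sum_nat[of "real n" p q] n
    by (simp add: gauss_2F1_series sums_iff add_ac)
  moreover have "(\<Sum>k. S_coeff n p q k * t ^ k)
      = ?P p * ?P q / ?P (p + q) * gauss_2F1 (real p) (real q) (real (p + q + n)) t"
  proof -
    have eq: "S_coeff n p q k * t ^ k = ?P p * ?P q / ?P (p + q) * (?h k * t ^ k)" for k
      by (simp add: S_coeff_def)
    have "summable (\<lambda>k. ?P p * ?P q / ?P (p + q) * (?h k * t ^ k))"
      using S_coeff_power_summable[OF assms, of p q] unfolding eq .
    then have "summable (\<lambda>k. ?h k * t ^ k)"
      using pos[of p] pos[of q] pos[of "p + q"] by (subst (asm) summable_cmult_iff) auto
    then show ?thesis
      unfolding eq gauss_2F1_series by (rule suminf_mult)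
  qed
  ultimately show ?thesis
    by (simp add: S_pq_def)
qed

lemma S_pq_squared_series:
  assumes n: "n \<ge> 1" and t: "0 \<le> t" "t \<le> 1"
  shows "(\<lambda>k. S2_coeff n p q k * t ^ k) sums (S_pq n p q t)\<^sup>2"
proof -
  have "summable (\<lambda>k. norm (S_coeff n p q k * t ^ k))"
    using S_coeff_power_summable[OF assms, of p q] S_coeff_nonneg[of n p q] t by (simp add: abs_mult)
  from Cauchy_product_sums[OF this this]
  have "(\<lambda>k. \<Sum>i\<le>k. S_coeff n p q i * t ^ i * (S_coeff n p q (k - i) * t ^ (k - i)))
          sums (S_pq n p q t)\<^sup>2"
    by (simp add: S_pq_series[OF assms] power2_eq_square)
  also have "(\<lambda>k. \<Sum>i\<le>k. S_coeff n p q i * t ^ i * (S_coeff n p q (k - i) * t ^ (k - i)))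
      = (\<lambda>k. S2_coeff n p q k * t ^ k)"
    unfolding S2_coeff_def sum_distrib_right
    by (intro ext sum.cong) (auto simp flip: power_add)
  finally show ?thesis .
qed

lemma S2_coeff_sums_1:
  assumes n: "n \<ge> 1"
  shows "S2_coeff n p q sums 1"
  using S_pq_squared_series[OF n, of 1 p q] S_pq_series[OF n, of 1 p q] S_coeff_sums_1[OF n, of p q]
  by (simp add: sums_iff)

section \<open>Two-sided bounds for power moments\<close>

text \<open>The larger of \<open>x\<close> and \<open>y\<close> lies between \<open>z / 2\<close> and \<open>z\<close>, so its power controls that of \<open>z\<close> whatever
the sign of the exponent. This decouples the two summation indices of a convolution.\<close>

lemma powr_le_powr_sum:
  fixes a x y z :: real
  assumes x: "0 < x" "x \<le> z" and y: "0 < y" "y \<le> z" and z: "z \<le> x + y"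
  shows "z powr a \<le> 2 powr \<bar>a\<bar> * (x powr a + y powr a)"
proof (cases "a \<ge> 0")
  case True
  define w where "w = max x y"
  have "z powr a \<le> (2 * w) powr a"
    using assms True by (intro powr_mono2) (auto simp: w_def)
  also have "\<dots> = 2 powr a * w powr a"
    using x y by (simp add: powr_mult w_def)
  also have "w powr a \<le> x powr a + y powr a"
    by (auto simp: w_def max_def)
  finally show ?thesis using True by simp
next
  case False
  have "z powr a \<le> x powr a"
    using assms False by (intro powr_mono2') auto
  also have "\<dots> \<le> 1 * (x powr a + y powr a)"
    by simp
  also have "\<dots> \<le> 2 powr \<bar>a\<bar> * (x powr a + y powr a)"
    by (intro mult_right_mono add_nonneg_nonneg ge_one_powr_ge_zero) auto
  finally show ?thesis .
qed

text \<open>The lower bound is the upper bound with \<open>x\<close> and \<open>y\<close> exchanged. A single constant serves both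
directions to keep later estimates short.\<close>

lemma poch_ratio_comparable:
  fixes x y :: real
  assumes x: "x > 0" and y: "y > 0"
  shows "\<exists>C>0. \<forall>m. poch_ratio x y m \<le> C * (real m + 1) powr (x - y) \<and>
                    (real m + 1) powr (x - y) \<le> C * poch_ratio x y m"
proof -
  obtain C where C: "C > 0" "\<And>m. poch_ratio x y m \<le> C * (real m + 1) powr (x - y)"
    using poch_ratio_upper[OF x y] by blast
  obtain D where D: "D > 0" "\<And>m. poch_ratio y x m \<le> D * (real m + 1) powr (y - x)"
    using poch_ratio_upper[OF y x] by blast
  have "(real m + 1) powr (x - y) \<le> D * poch_ratio x y m" for m
  proof -
    have "1 = poch_ratio y x m * poch_ratio x y m"
      using poch_ratio_pos[OF x y, of m] by (simp add: poch_ratio_swap[of y])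
    also have "\<dots> \<le> D * (real m + 1) powr (y - x) * poch_ratio x y m"
      using D(2)[of m] poch_ratio_pos[OF x y, of m] by (intro mult_right_mono) auto
    also have "\<dots> = D * poch_ratio x y m / (real m + 1) powr (x - y)"
      by (simp add: powr_diff)
    finally show ?thesis by (simp add: pos_le_divide_eq)
  qed
  moreover have "D * poch_ratio x y m \<le> max C D * poch_ratio x y m" for m
    using poch_ratio_pos[OF x y, of m] by (intro mult_right_mono) auto
  moreover have "C * (real m + 1) powr (x - y) \<le> max C D * (real m + 1) powr (x - y)" for m
    by (intro mult_right_mono) auto
  moreover have "max C D > 0" using C(1) by simp
  ultimately show ?thesis
    using C(2) order_trans by blast
qed

text \<open>The coefficients of \<open>S_pq\<^sup>2\<close> are regarded as the weights of a random variable with values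
\<open>p + q + k + 1\<close>.\<close>

definition power_moment :: "nat \<Rightarrow> real \<Rightarrow> nat \<Rightarrow> nat \<Rightarrow> real" where
  "power_moment n a p q = (\<Sum>k. S2_coeff n p q k * (real (p + q + k) + 1) powr a)"

text \<open>In the convolution, \<open>(p + q + i + j + 1) powr a\<close> is at most a constant times the sum of
\<open>(p + q + i + 1) powr a\<close> and \<open>(p + q + j + 1) powr a\<close>. Since the coefficients of \<open>S_pq\<close> have total
mass \<open>1\<close>, this reduces the double sum to a single one, which \<open>S_coeff_moment\<close> with \<open>\<nu> = n - a\<close>
evaluates after powers have been replaced by Pochhammer quotients. The condition \<open>a < n\<close> is \<open>\<nu> > 0\<close>.\<close>

lemma power_moment_upper:
  assumes n: "n \<ge> 1" and a: "a < real n"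
  shows "\<exists>C>0. \<forall>p q. summable (\<lambda>k. S2_coeff n p q k * (real (p + q + k) + 1) powr a) \<and>
           power_moment n a p q \<le> C * ((real p + 1) * (real q + 1)) powr a"
proof -
  define W where "W = poch_ratio (real n) (real n - a)"
  have "\<exists>C>0. \<forall>m. W m \<le> C * (real m + 1) powr a \<and> (real m + 1) powr a \<le> C * W m"
    using poch_ratio_comparable[of "real n" "real n - a"] n a by (simp add: W_def)
  then obtain C where C: "C > 0"
      "\<And>m. W m \<le> C * (real m + 1) powr a" "\<And>m. (real m + 1) powr a \<le> C * W m"
    by blast
  have Wpos: "W m > 0" for m
    using n a by (simp add: W_def poch_ratio_pos)
  \<comment> \<open>One factor \<open>C\<close> turns the powers into Pochhammer quotients, two more turn the resulting
      product of two quotients back into powers; the leading \<open>2\<close> counts the two indices of the convolution.\<close>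
  define B where "B = 2 * 2 powr \<bar>a\<bar> * C ^ 3"
  have "summable (\<lambda>k. S2_coeff n p q k * (real (p + q + k) + 1) powr a) \<and>
        power_moment n a p q \<le> B * ((real p + 1) * (real q + 1)) powr a" for p q
  proof -
    define b where "b = S_coeff n p q"
    define X where "X k = (real (p + q + k) + 1) powr a" for k
    define u where "u k = b k * X k" for k
    have b0: "b k \<ge> 0" for k by (simp add: b_def S_coeff_nonneg)
    have b1: "b sums 1" unfolding b_def by (rule S_coeff_sums_1[OF n])
    have X0: "X k \<ge> 0" and u0: "u k \<ge> 0" for k by (simp_all add: X_def u_def b0)
    have mom: "(\<lambda>k. b k * W (p + q + k)) sums (W p * W q)"
      unfolding b_def W_def by (rule S_coeff_moment) (use n a in auto)
    have ule: "u k \<le> C * (b k * W (p + q + k))" for k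
      using mult_left_mono[OF C(3)[of "p + q + k"] b0[of k]] by (simp add: u_def X_def mult_ac)
    have su: "summable u"
      by (rule summable_comparison_test'[where N = 0, OF summable_mult[OF sums_summable[OF mom], of C]])
         (use ule u0 in auto)
    have "suminf u \<le> (\<Sum>k. C * (b k * W (p + q + k)))"
      by (rule suminf_le[OF ule su]) (intro summable_mult sums_summable[OF mom])
    also have "\<dots> = C * (W p * W q)"
      using mom by (simp add: sums_iff suminf_mult)
    also have "\<dots> \<le> C * ((C * (real p + 1) powr a) * (C * (real q + 1) powr a))"
      using C Wpos by (intro mult_left_mono mult_mono) (auto intro: less_imp_le)
    finally have usum: "suminf u \<le> C ^ 3 * ((real p + 1) * (real q + 1)) powr a"
      by (simp add: powr_mult power3_eq_cube mult_ac)
    have nb: "summable (\<lambda>k. norm (b k))" "summable (\<lambda>k. norm (u k))"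
      using su b1 b0 u0 by (simp_all add: sums_iff)
    have 1: "(\<lambda>k. \<Sum>i\<le>k. u i * b (k - i)) sums suminf u"
      using Cauchy_product_sums[OF nb(2,1)] b1 by (simp add: sums_iff)
    have 2: "(\<lambda>k. \<Sum>i\<le>k. b i * u (k - i)) sums suminf u"
      using Cauchy_product_sums[OF nb(1,2)] b1 by (simp add: sums_iff)
    have 3: "(\<lambda>k. 2 powr \<bar>a\<bar> * ((\<Sum>i\<le>k. u i * b (k - i)) + (\<Sum>i\<le>k. b i * u (k - i))))
               sums (2 powr \<bar>a\<bar> * (suminf u + suminf u))"
      by (intro sums_mult sums_add 1 2)
    have le: "S2_coeff n p q k * X k
            \<le> 2 powr \<bar>a\<bar> * ((\<Sum>i\<le>k. u i * b (k - i)) + (\<Sum>i\<le>k. b i * u (k - i)))" for k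
    proof -
      have "S2_coeff n p q k * X k = (\<Sum>i\<le>k. b i * b (k - i) * X k)"
        by (simp add: S2_coeff_def b_def sum_distrib_right)
      also have "\<dots> \<le> (\<Sum>i\<le>k. b i * b (k - i) * (2 powr \<bar>a\<bar> * (X i + X (k - i))))"
        unfolding X_def
        by (intro sum_mono mult_left_mono powr_le_powr_sum mult_nonneg_nonneg b0) auto
      also have "\<dots> = 2 powr \<bar>a\<bar> * ((\<Sum>i\<le>k. u i * b (k - i)) + (\<Sum>i\<le>k. b i * u (k - i)))"
        unfolding sum_distrib_left sum.distrib[symmetric]
        by (intro sum.cong) (auto simp: u_def algebra_simps)
      finally show ?thesis .
    qed
    have summ: "summable (\<lambda>k. S2_coeff n p q k * X k)"
      by (rule summable_comparison_test'[where N = 0, OF sums_summable[OF 3]])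
         (use le S2_coeff_nonneg X0 in \<open>auto simp: abs_mult\<close>)
    have "(\<Sum>k. S2_coeff n p q k * X k) \<le> 2 powr \<bar>a\<bar> * (suminf u + suminf u)"
      using suminf_le[OF le summ sums_summable[OF 3]] 3 by (simp add: sums_iff)
    also have "\<dots> \<le> 2 powr \<bar>a\<bar> * (2 * (C ^ 3 * ((real p + 1) * (real q + 1)) powr a))"
      using usum by (intro mult_left_mono) auto
    finally show ?thesis
      using summ by (simp add: B_def X_def power_moment_def mult_ac)
  qed
  moreover have "B > 0" using C(1) by (simp add: B_def)
  ultimately show ?thesis by blast
qed

text \<open>For \<open>r \<ge> \<epsilon>\<close> the first summand is at least \<open>1\<close>, for \<open>r < \<epsilon>\<close> the second one is. Averaged over a
probability distribution this is an effective substitute for Hoelder's inequality between a moment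
and a moment of opposite sign.\<close>

lemma one_le_tradeoff:
  fixes r \<epsilon> \<eta> :: real
  assumes "r > 0" "\<epsilon> > 0" "\<eta> \<ge> 0"
  shows "1 \<le> r / \<epsilon> + \<epsilon> powr \<eta> * r powr (- \<eta>)"
proof (cases "r \<ge> \<epsilon>")
  case True
  then have "1 \<le> r / \<epsilon>" using assms by simp
  moreover have "0 \<le> \<epsilon> powr \<eta> * r powr (- \<eta>)" by simp
  ultimately show ?thesis by linarith
next
  case False
  then have "1 \<le> (\<epsilon> / r) powr \<eta>"
    using assms by (intro ge_one_powr_ge_zero) auto
  also have "\<dots> = \<epsilon> powr \<eta> * r powr (- \<eta>)"
    using assms by (simp add: powr_divide powr_minus_divide)
  finally show ?thesis
    using divide_pos_pos[OF assms(1,2)] by linarith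
qed

text \<open>The lower bound for the moment of order \<open>a\<close> follows from the upper bound for the moment of the
opposite, small order \<open>- \<eta> * a\<close>: because the total mass is \<open>1\<close>, averaging \<open>one_le_tradeoff\<close> with
\<open>r = ((p + q + k + 1) / ((p + 1) * (q + 1))) powr a\<close> shows that the two normalized moments cannot
both be small.\<close>

lemma power_moment_lower:
  assumes n: "n \<ge> 1" and a: "a < real n"
  shows "\<exists>c>0. \<forall>p q. c * ((real p + 1) * (real q + 1)) powr a \<le> power_moment n a p q"
proof -
  \<comment> \<open>Any small \<open>\<eta> > 0\<close> serves; this one gives \<open>\<bar>\<eta> * a\<bar> < 1 \<le> n\<close> uniformly in the sign of \<open>a\<close>.\<close>
  define \<eta> where "\<eta> = 1 / (1 + \<bar>a\<bar>)"
  have \<eta>: "\<eta> > 0" by (simp add: \<eta>_def add_pos_nonneg)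
  have "1 + \<bar>a\<bar> > 0" "- a < 1 + \<bar>a\<bar>" by linarith+
  then have "- \<eta> * a < 1"
    by (simp add: \<eta>_def minus_divide_left[symmetric] pos_divide_less_eq minus_less_iff pos_less_divide_eq)
  then have d: "- \<eta> * a < real n" using n by linarith
  obtain D where D: "D > 0"
      "\<And>p q. summable (\<lambda>k. S2_coeff n p q k * (real (p + q + k) + 1) powr (- \<eta> * a))"
      "\<And>p q. power_moment n (- \<eta> * a) p q \<le> D * ((real p + 1) * (real q + 1)) powr (- \<eta> * a)"
    using power_moment_upper[OF n d] by blast
  have sa: "summable (\<lambda>k. S2_coeff n p q k * (real (p + q + k) + 1) powr a)" for p q
    using power_moment_upper[OF n a] by blast
  \<comment> \<open>Chosen so that the moment of order \<open>- \<eta> * a\<close> contributes at most \<open>1 / 2\<close>.\<close>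
  define \<epsilon> where "\<epsilon> = (1 / (2 * D)) powr (1 / \<eta>)"
  have \<epsilon>: "\<epsilon> > 0" "\<epsilon> powr \<eta> = 1 / (2 * D)"
    using D(1) \<eta> by (simp_all add: \<epsilon>_def powr_powr)
  have "\<epsilon> / 2 * ((real p + 1) * (real q + 1)) powr a \<le> power_moment n a p q" for p q
  proof -
    define Y where "Y = (real p + 1) * (real q + 1)"
    have Y: "Y > 0" by (simp add: Y_def)
    let ?A = "S2_coeff n p q" and ?X = "\<lambda>k. real (p + q + k) + 1"
    have le: "?A k \<le> 1 / (\<epsilon> * Y powr a) * (?A k * ?X k powr a)
                 + \<epsilon> powr \<eta> / Y powr (- \<eta> * a) * (?A k * ?X k powr (- \<eta> * a))" for k
    proof -
      have "1 \<le> (?X k / Y) powr a / \<epsilon> + \<epsilon> powr \<eta> * ((?X k / Y) powr a) powr (- \<eta>)"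
        by (rule one_le_tradeoff) (use Y \<epsilon>(1) \<eta> in auto)
      also have "((?X k / Y) powr a) powr (- \<eta>) = (?X k / Y) powr (- \<eta> * a)"
        by (simp add: powr_powr mult.commute)
      finally have "?A k * 1 \<le> ?A k * ((?X k / Y) powr a / \<epsilon> + \<epsilon> powr \<eta> * (?X k / Y) powr (- \<eta> * a))"
        by (rule mult_left_mono) (rule S2_coeff_nonneg)
      also have "(?X k / Y) powr a = ?X k powr a / Y powr a"
        by (rule powr_divide)
      also have "(?X k / Y) powr (- \<eta> * a) = ?X k powr (- \<eta> * a) / Y powr (- \<eta> * a)"
        by (rule powr_divide)
      also have "A * (x / y / \<epsilon> + g * (u / w)) = 1 / (\<epsilon> * y) * (A * x) + g / w * (A * u)"
        for A x y g u w :: real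
        by (simp add: distrib_left mult_ac)
      finally show ?thesis by simp
    qed
    have s: "(\<lambda>k. 1 / (\<epsilon> * Y powr a) * (?A k * ?X k powr a)
                 + \<epsilon> powr \<eta> / Y powr (- \<eta> * a) * (?A k * ?X k powr (- \<eta> * a)))
        sums (1 / (\<epsilon> * Y powr a) * power_moment n a p q
              + \<epsilon> powr \<eta> / Y powr (- \<eta> * a) * power_moment n (- \<eta> * a) p q)"
      unfolding power_moment_def by (intro sums_add sums_mult summable_sums sa D(2))
    have "1 \<le> 1 / (\<epsilon> * Y powr a) * power_moment n a p q
              + \<epsilon> powr \<eta> / Y powr (- \<eta> * a) * power_moment n (- \<eta> * a) p q"
      by (rule sums_le[OF le S2_coeff_sums_1[OF n] s])
    also have "\<epsilon> powr \<eta> / Y powr (- \<eta> * a) * power_moment n (- \<eta> * a) p q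
        \<le> \<epsilon> powr \<eta> / Y powr (- \<eta> * a) * (D * Y powr (- \<eta> * a))"
      unfolding Y_def by (intro mult_left_mono D(3)) auto
    also have "\<dots> = 1 / 2"
      using D(1) Y by (simp add: \<epsilon>(2))
    finally have "1 / 2 \<le> 1 / (\<epsilon> * Y powr a) * power_moment n a p q" by linarith
    then show ?thesis
      using \<epsilon>(1) Y by (simp add: Y_def field_simps)
  qed
  then show ?thesis using \<epsilon>(1) by (intro exI[of _ "\<epsilon> / 2"]) auto
qed


section \<open>A series for the analytic continuation\<close>

text \<open>The candidate for the analytic continuation, over the reals and over the complex numbers at once.
Integration of a monomial \<open>t ^ (p + q + n - 1 + k)\<close> against \<open>(1 - t) powr z\<close> gives a Beta value whose
poles at \<open>z = -1, \<dots>, -n\<close> cancel against \<open>pochhammer (z + 1) n\<close>; the quotient below is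
what remains, and its poles all satisfy \<open>Re z \<le> -n - 1\<close>.\<close>

definition c_series :: "nat \<Rightarrow> nat \<Rightarrow> nat \<Rightarrow> 'a \<Rightarrow> 'a::{real_normed_field,banach}" where
  "c_series n p q z = (\<Sum>k. of_real (S2_coeff n p q k) * poch_ratio (of_nat n) (of_nat n + 1 + z) (p + q + k))"

lemma c_series_summable:
  assumes n: "n \<ge> 1" and s: "s > - real n - 1"
  shows "summable (\<lambda>k. S2_coeff n p q k * poch_ratio (real n) (real n + 1 + s) (p + q + k))"
proof -
  obtain C where C: "C > 0"
      "\<And>m. poch_ratio (real n) (real n + 1 + s) m \<le> C * (real m + 1) powr (real n - (real n + 1 + s))"
    using poch_ratio_upper[of "real n" "real n + 1 + s"] n s by auto
  have *: "real n - (real n + 1 + s) < real n" using s by simp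
  have "summable (\<lambda>k. S2_coeff n p q k * (real (p + q + k) + 1) powr (real n - (real n + 1 + s)))"
    using power_moment_upper[OF n *] by blast
  then have "summable (\<lambda>k. C * (S2_coeff n p q k * (real (p + q + k) + 1) powr (real n - (real n + 1 + s))))"
    by (rule summable_mult)
  then show ?thesis
  proof (rule summable_comparison_test'[where N = 0])
    fix k
    have "poch_ratio (real n) (real n + 1 + s) (p + q + k) > 0"
      using n s by (intro poch_ratio_pos) auto
    then show "norm (S2_coeff n p q k * poch_ratio (real n) (real n + 1 + s) (p + q + k))
        \<le> C * (S2_coeff n p q k * (real (p + q + k) + 1) powr (real n - (real n + 1 + s)))"
      using mult_left_mono[OF C(2)[of "p + q + k"] S2_coeff_nonneg[of n p q k]] S2_coeff_nonneg[of n p q k]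
      by (simp add: abs_mult mult_ac)
  qed
qed

text \<open>The Pochhammer quotient behaves like \<open>(p + q + k + 1) powr (- s - 1)\<close>, so the series is comparable to
the power moment of order \<open>a = - s - 1\<close>, and \<open>a < n\<close> is exactly the range of \<open>s\<close>.\<close>

lemma c_series_comparable:
  assumes n: "n \<ge> 1" and s: "s > - real n - 1"
  shows "\<exists>c C. 0 < c \<and> c < C \<and> (\<forall>p q.
           c \<le> (real p + 1) powr (s + 1) * (real q + 1) powr (s + 1) * c_series n p q s \<and>
           (real p + 1) powr (s + 1) * (real q + 1) powr (s + 1) * c_series n p q s \<le> C)"
proof -
  let ?a = "- (s + 1)"
  let ?W = "poch_ratio (real n) (real n + 1 + s)"
  let ?Y = "\<lambda>p q. (real p + 1) powr (s + 1) * (real q + 1) powr (s + 1)"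
  have a: "?a < real n" using s by simp
  have eq: "real n - (real n + 1 + s) = ?a" by simp
  have "\<exists>C>0. \<forall>m. ?W m \<le> C * (real m + 1) powr ?a \<and> (real m + 1) powr ?a \<le> C * ?W m"
    using poch_ratio_comparable[of "real n" "real n + 1 + s"] n s unfolding eq by simp
  then obtain C where C: "C > 0"
      "\<And>m. ?W m \<le> C * (real m + 1) powr ?a" "\<And>m. (real m + 1) powr ?a \<le> C * ?W m"
    by blast
  obtain D where D: "D > 0"
      "\<And>p q. summable (\<lambda>k. S2_coeff n p q k * (real (p + q + k) + 1) powr ?a)"
      "\<And>p q. power_moment n ?a p q \<le> D * ((real p + 1) * (real q + 1)) powr ?a"
    using power_moment_upper[OF n a] by blast
  obtain d where d: "d > 0"
      "\<And>p q. d * ((real p + 1) * (real q + 1)) powr ?a \<le> power_moment n ?a p q"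
    using power_moment_lower[OF n a] by blast
  have Y: "((real p + 1) * (real q + 1)) powr ?a * ?Y p q = 1" for p q
  proof -
    have "((real p + 1) * (real q + 1)) powr ?a * ((real p + 1) * (real q + 1)) powr (s + 1) = 1"
      by (simp flip: powr_add)
    then show ?thesis by (simp add: powr_mult)
  qed
  have up: "c_series n p q s \<le> C * power_moment n ?a p q" for p q
  proof -
    have "c_series n p q s \<le> (\<Sum>k. C * (S2_coeff n p q k * (real (p + q + k) + 1) powr ?a))"
      unfolding c_series_def of_real_eq_id id_apply
    proof (rule suminf_le[OF _ c_series_summable[OF n s] summable_mult[OF D(2)]])
      show "S2_coeff n p q k * ?W (p + q + k)
          \<le> C * (S2_coeff n p q k * (real (p + q + k) + 1) powr ?a)" for k
        using mult_left_mono[OF C(2)[of "p + q + k"] S2_coeff_nonneg[of n p q k]]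
        by (simp only: mult_ac)
    qed
    also have "\<dots> = C * power_moment n ?a p q"
      unfolding power_moment_def by (rule suminf_mult[OF D(2)])
    finally show ?thesis .
  qed
  have low: "power_moment n ?a p q \<le> C * c_series n p q s" for p q
  proof -
    have "power_moment n ?a p q \<le> (\<Sum>k. C * (S2_coeff n p q k * ?W (p + q + k)))"
      unfolding power_moment_def
    proof (rule suminf_le[OF _ D(2) summable_mult[OF c_series_summable[OF n s]]])
      show "S2_coeff n p q k * (real (p + q + k) + 1) powr ?a
          \<le> C * (S2_coeff n p q k * ?W (p + q + k))" for k
        using mult_left_mono[OF C(3)[of "p + q + k"] S2_coeff_nonneg[of n p q k]]
        by (simp only: mult_ac)
    qed
    also have "\<dots> = C * c_series n p q s"
      unfolding c_series_def of_real_eq_id id_apply by (rule suminf_mult[OF c_series_summable[OF n s]])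
    finally show ?thesis .
  qed
  have 1: "?Y p q * c_series n p q s \<le> C * D" for p q
  proof -
    have "?Y p q * c_series n p q s \<le> ?Y p q * (C * (D * ((real p + 1) * (real q + 1)) powr ?a))"
      by (intro mult_left_mono order_trans[OF up] D(3)) (use C(1) in auto)
    also have "\<dots> = C * D * (((real p + 1) * (real q + 1)) powr ?a * ?Y p q)"
      by (simp only: mult_ac)
    finally show ?thesis unfolding Y by simp
  qed
  have 2: "d / C \<le> ?Y p q * c_series n p q s" for p q
  proof -
    have "d = d * (((real p + 1) * (real q + 1)) powr ?a * ?Y p q)"
      unfolding Y by simp
    also have "\<dots> = ?Y p q * (d * ((real p + 1) * (real q + 1)) powr ?a)"
      by (simp only: mult_ac)
    also have "\<dots> \<le> ?Y p q * (C * c_series n p q s)"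
      using d(2)[of p q] low[of p q] by (intro mult_left_mono) auto
    also have "\<dots> = ?Y p q * c_series n p q s * C" by (simp only: mult_ac)
    finally show ?thesis using C(1) by (simp only: pos_divide_le_eq)
  qed
  \<comment> \<open>The summand \<open>d / C\<close> only serves to make the upper constant strictly larger than the lower one.\<close>
  have "0 < d / C" "d / C < C * D + d / C" using C(1) D(1) d(1) by simp_all
  moreover have "?Y p q * c_series n p q s \<le> C * D + d / C" for p q
    using 1[of p q] \<open>0 < d / C\<close> by linarith
  ultimately show ?thesis using 2 by blast
qed

section \<open>Identification of the continuation\<close>

text \<open>All Gamma factors with argument \<open>s + 1\<close> cancel, which is why the right-hand side continues beyond
\<open>s = -1\<close>.\<close>

lemma pochhammer_times_Beta:
  fixes s :: real
  assumes n: "n \<ge> 1" and s: "s > - 1"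
  shows "pochhammer (s + 1) n / Gamma (real n) * Beta (real (n + m)) (s + 1)
           = poch_ratio (real n) (real n + 1 + s) m"
proof -
  have ni: "real n \<notin> \<int>\<^sub>\<le>\<^sub>0" "s + 1 \<notin> \<int>\<^sub>\<le>\<^sub>0" "real n + 1 + s \<notin> \<int>\<^sub>\<le>\<^sub>0"
    using n s by (auto elim!: nonpos_Ints_cases)
  have pos: "Gamma (real n) > 0" "Gamma (s + 1) > 0" "Gamma (real n + 1 + s) > 0"
    using n s by (auto intro!: Gamma_real_pos)
  have "pochhammer (s + 1) n = Gamma (real n + 1 + s) / Gamma (s + 1)"
    using pochhammer_Gamma[OF ni(2), of n] by (simp add: add_ac)
  moreover have "pochhammer (real n) m = Gamma (real (n + m)) / Gamma (real n)"
    using pochhammer_Gamma[OF ni(1), of m] by (simp add: add_ac)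
  moreover have "pochhammer (real n + 1 + s) m = Gamma (real (n + m) + (s + 1)) / Gamma (real n + 1 + s)"
    using pochhammer_Gamma[OF ni(3), of m] by (simp add: add_ac)
  ultimately show ?thesis
    using pos by (simp add: poch_ratio_def Beta_def)
qed

text \<open>The Taylor coefficients of \<open>S_pq\<^sup>2\<close> are nonnegative, so the monotone convergence theorem permits
termwise integration.\<close>

lemma c_integral_eq_c_series:
  assumes n: "n \<ge> 1" and s: "s > - 1"
  shows "c_integral n p q s = c_series n p q s"
proof -
  define N where "N = p + q + n - 1"
  define K where "K = pochhammer (s + 1) n / Gamma (real n)"
  define A where "A = S2_coeff n p q"
  define W where "W k = poch_ratio (real n) (real n + 1 + s) (p + q + k)" for k
  have K: "K > 0"
    using n s by (auto simp: K_def intro!: divide_pos_pos pochhammer_pos Gamma_real_pos)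
  have beta: "((\<lambda>t. t ^ (N + k) * (1 - t) powr s) has_integral W k / K) {0..1}" for k
  proof -
    have "((\<lambda>t. t powr (real (n + (p + q + k)) - 1) * (1 - t) powr (s + 1 - 1)) has_integral
            Beta (real (n + (p + q + k))) (s + 1)) {0..1}"
      using n s by (intro has_integral_Beta_real) auto
    also have "Beta (real (n + (p + q + k))) (s + 1) = W k / K"
      using pochhammer_times_Beta[OF n s, of "p + q + k"] K
      unfolding K_def[symmetric] W_def[symmetric] by (simp add: eq_divide_eq mult.commute)
    finally show ?thesis
    \<comment> \<open>At \<open>t = 0\<close> the two integrands differ when \<open>N + k = 0\<close>, since \<open>0 powr 0 = 0\<close> but \<open>0 ^ 0 = 1\<close>.\<close>
    proof (rule has_integral_spike_finite[of "{0}", rotated 2])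
      fix t :: real assume t: "t \<in> {0..1} - {0}"
      have "real (n + (p + q + k)) - 1 = real (N + k)" using n by (simp add: N_def)
      moreover have "t powr real (N + k) = t ^ (N + k)" using t by (intro powr_realpow) simp
      ultimately show "t ^ (N + k) * (1 - t) powr s
          = t powr (real (n + (p + q + k)) - 1) * (1 - t) powr (s + 1 - 1)"
        by (simp only: add_diff_cancel_right')
    qed simp
  qed
  have sW: "summable (\<lambda>k. A k * W k)"
    unfolding A_def W_def by (rule c_series_summable) (use n s in auto)
  have "((\<lambda>t. t ^ N * (1 - t) powr s * (S_pq n p q t)\<^sup>2) has_integral (\<Sum>k. A k * W k) / K) {0..1}"
  proof (rule has_integral_monotone_convergence_increasing)
    show "((\<lambda>t. \<Sum>k<m. A k * (t ^ (N + k) * (1 - t) powr s)) has_integral (\<Sum>k<m. A k * (W k / K))) {0..1}" for m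
      by (intro has_integral_sum has_integral_mult_right beta) auto
    show "(\<Sum>k<m. A k * (t ^ (N + k) * (1 - t) powr s))
        \<le> (\<Sum>k<Suc m. A k * (t ^ (N + k) * (1 - t) powr s))" if "t \<in> {0..1}" for m t
      using that S2_coeff_nonneg[of n p q m] by (simp add: A_def)
    show "(\<lambda>m. \<Sum>k<m. A k * (t ^ (N + k) * (1 - t) powr s))
        \<longlonglongrightarrow> t ^ N * (1 - t) powr s * (S_pq n p q t)\<^sup>2" if "t \<in> {0..1}" for t
    proof -
      have "(\<lambda>k. t ^ N * (1 - t) powr s * (A k * t ^ k)) sums (t ^ N * (1 - t) powr s * (S_pq n p q t)\<^sup>2)"
        unfolding A_def using that by (intro sums_mult S_pq_squared_series n) auto
      then show ?thesis by (simp add: sums_def power_add mult_ac)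
    qed
    have "(\<lambda>k. A k * W k / K) sums ((\<Sum>k. A k * W k) / K)"
      by (intro sums_divide summable_sums sW)
    then show "(\<lambda>m. \<Sum>k<m. A k * (W k / K)) \<longlonglongrightarrow> (\<Sum>k. A k * W k) / K"
      by (simp add: sums_def)
  qed
  then have "integral {0..1} (\<lambda>t. t ^ N * (1 - t) powr s * (S_pq n p q t)\<^sup>2) = (\<Sum>k. A k * W k) / K"
    by (rule integral_unique)
  then show ?thesis
    using K by (simp add: c_integral_def c_series_def A_def W_def N_def flip: K_def)
qed

text \<open>Each factor satisfies \<open>\<bar>z + i\<bar> \<ge> Re z + i \<ge> \<sigma> + i\<close>. Hence the complex series is dominated,
uniformly on half-planes, by the real series at the boundary abscissa.\<close>

lemma norm_pochhammer_ge:
  fixes z :: complex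
  assumes "0 < \<sigma>" "\<sigma> \<le> Re z"
  shows "pochhammer \<sigma> m \<le> norm (pochhammer z m)"
  unfolding pochhammer_prod prod_norm[symmetric]
proof (intro prod_mono conjI)
  fix i
  show "0 \<le> \<sigma> + of_nat i" using assms by simp
  have "\<sigma> + real i \<le> Re (z + of_nat i)" using assms by simp
  also have "\<dots> \<le> norm (z + of_nat i)" by (rule complex_Re_le_cmod)
  finally show "\<sigma> + of_nat i \<le> norm (z + of_nat i)" .
qed

text \<open>Weierstrass' criterion: around \<open>z\<close>, a disc of half the distance to the line \<open>Re z = -n - 1\<close> stays in a
smaller half-plane \<open>Re w \<ge> s\<close>, where the real series at \<open>s\<close> is a convergent majorant.\<close>

lemma c_series_holomorphic:
  assumes n: "n \<ge> 1"
  shows "c_series n p q holomorphic_on {z. Re z > - real n - 1}"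
proof (rule holomorphic_uniform_sequence)
  let ?H = "{z. Re z > - real n - 1}"
  let ?f = "\<lambda>k z. of_real (S2_coeff n p q k) * poch_ratio (of_nat n) (of_nat n + 1 + z) (p + q + k) :: complex"
  show "open ?H" by (rule open_halfspace_Re_gt)
  show "(\<lambda>z. \<Sum>k<m. ?f k z) holomorphic_on ?H" for m
  proof (intro holomorphic_on_sum holomorphic_on_mult holomorphic_on_const)
    fix k
    have "of_nat n + 1 + z + of_nat i \<noteq> 0" if "z \<in> ?H" for z :: complex and i
    proof
      assume "of_nat n + 1 + z + of_nat i = 0"
      then have "Re (of_nat n + 1 + z + of_nat i) = 0" by simp
      with that show False by simp
    qed
    then show "(\<lambda>z. poch_ratio (of_nat n) (of_nat n + 1 + z) (p + q + k) :: complex) holomorphic_on ?H"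
      unfolding poch_ratio_def pochhammer_prod by (intro holomorphic_intros) auto
  qed
  show "\<exists>d>0. cball z d \<subseteq> ?H \<and>
      uniform_limit (cball z d) (\<lambda>m z. \<Sum>k<m. ?f k z) (c_series n p q) sequentially"
    if z: "z \<in> ?H" for z
  proof -
    define d where "d = (Re z + real n + 1) / 2"
    define s where "s = Re z - d"
    have d: "d > 0" "s > - real n - 1" using z by (simp_all add: d_def s_def field_simps)
    have Re: "s \<le> Re w" if "w \<in> cball z d" for w
      using abs_Re_le_cmod[of "z - w"] that by (simp add: s_def dist_norm)
    have "uniform_limit (cball z d) (\<lambda>m z. \<Sum>k<m. ?f k z) (\<lambda>w. \<Sum>k. ?f k w) sequentially"
    proof (rule Weierstrass_m_test)
      show "summable (\<lambda>k. S2_coeff n p q k * poch_ratio (real n) (real n + 1 + s) (p + q + k))"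
        using n d by (intro c_series_summable) auto
      fix k w assume w: "w \<in> cball z d"
      have pos: "pochhammer (real n) m > 0" "pochhammer (real n + 1 + s) m > 0" for m
        using n d by (auto intro: pochhammer_pos)
      have "norm (pochhammer (of_nat n :: complex) m) = pochhammer (real n) m" for m
        using pos(1)[of m] pochhammer_of_real[of "real n" m, where 'a = complex] by simp
      moreover have "pochhammer (real n + 1 + s) m \<le> norm (pochhammer (of_nat n + 1 + w) m)" for m
        using Re[OF w] d by (intro norm_pochhammer_ge) auto
      ultimately have "norm (poch_ratio (of_nat n) (of_nat n + 1 + w) m)
          \<le> poch_ratio (real n) (real n + 1 + s) m" for m
        unfolding poch_ratio_def norm_divide by (simp only:) (intro frac_le; use pos[of m] in simp)
      then show "norm (?f k w) \<le> S2_coeff n p q k * poch_ratio (real n) (real n + 1 + s) (p + q + k)"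
        using S2_coeff_nonneg[of n p q k] by (simp add: norm_mult mult_left_mono)
    qed
    moreover have "cball z d \<subseteq> ?H" using Re d by fastforce
    ultimately show ?thesis using d unfolding c_series_def by blast
  qed
qed

lemma c_series_of_real:
  assumes n: "n \<ge> 1" and s: "s > - real n - 1"
  shows "c_series n p q (complex_of_real s) = complex_of_real (c_series n p q s)"
proof -
  have "of_real (S2_coeff n p q k) * poch_ratio (of_nat n) (of_nat n + 1 + complex_of_real s) (p + q + k)
      = complex_of_real (S2_coeff n p q k * poch_ratio (real n) (real n + 1 + s) (p + q + k))" for k
    unfolding poch_ratio_def of_real_mult of_real_divide pochhammer_of_real[symmetric] by simp
  then show ?thesis
    unfolding c_series_def of_real_eq_id id_apply suminf_of_real[OF c_series_summable[OF n s]]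
    by (simp only: of_real_of_nat_eq)
qed

lemma c_extension_c_series:
  assumes n: "n \<ge> 1"
  shows "c_extension n p q (c_series n p q)"
  unfolding c_extension_def
  using c_series_holomorphic[OF n] c_series_of_real[OF n] c_integral_eq_c_series[OF n] by simp

text \<open>Two extensions agree on the real half-line \<open>s > -1\<close>, which accumulates at \<open>0\<close>; the identity theorem on
the connected half-plane does the rest.\<close>

lemma c_extension_unique:
  assumes g: "c_extension n p q g" and h: "c_extension n p q h" and z: "Re z > - real n - 1"
  shows "g z = h z"
proof -
  let ?H = "{z. Re z > - real n - 1}" and ?U = "complex_of_real ` {-1<..}"
  have "g z - h z = 0"
  proof (rule analytic_continuation[of "\<lambda>z. g z - h z" ?H ?U 0])
    show "(\<lambda>z. g z - h z) holomorphic_on ?H"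
      using g h unfolding c_extension_def by (intro holomorphic_on_diff) auto
    show "connected ?H" by (intro convex_connected convex_halfspace_Re_gt)
    show "(0::complex) islimpt ?U"
    proof (rule islimptI)
      fix T :: "complex set" assume "0 \<in> T" "open T"
      then obtain e where e: "e > 0" "ball 0 e \<subseteq> T" by (meson openE)
      have "complex_of_real (e / 2) \<in> ?U" using e(1) by (intro imageI) simp
      moreover have "complex_of_real (e / 2) \<in> T" "complex_of_real (e / 2) \<noteq> 0"
        using e by (auto simp: subset_iff)
      ultimately show "\<exists>y\<in>?U. y \<in> T \<and> y \<noteq> 0" by blast
    qed
    show "g w - h w = 0" if "w \<in> ?U" for w
      using that g h unfolding c_extension_def by auto
  qed (use z in \<open>auto simp: open_halfspace_Re_gt\<close>)
  then show ?thesis by simp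
qed

lemma c_pq_eq_c_series:
  assumes n: "n \<ge> 1" and s: "s > - real n - 1"
  shows "c_pq n p q s = c_series n p q s"
proof (cases "s > -1")
  case True
  then show ?thesis using c_integral_eq_c_series[OF n] by (simp add: c_pq_def)
next
  case False
  have "(THE v. \<exists>g. c_extension n p q g \<and> g (complex_of_real s) = complex_of_real v) = c_series n p q s"
  proof (rule the_equality)
    show "\<exists>g. c_extension n p q g \<and> g (complex_of_real s) = complex_of_real (c_series n p q s)"
      using c_extension_c_series[OF n] c_series_of_real[OF n s] by blast
  next
    fix v assume "\<exists>g. c_extension n p q g \<and> g (complex_of_real s) = complex_of_real v"
    then obtain g where g: "c_extension n p q g" "g (complex_of_real s) = complex_of_real v" by blast
    have "complex_of_real v = complex_of_real (c_series n p q s)"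
      using c_extension_unique[OF g(1) c_extension_c_series[OF n], of "complex_of_real s"] s g(2)
        c_series_of_real[OF n s] by simp
    then show "v = c_series n p q s" by simp
  qed
  with False show ?thesis by (simp add: c_pq_def)
qed

theorem corollary7:
  fixes n :: nat and s :: real
  assumes "n \<ge> 1" and "s > - real n - 1"
  shows "\<exists>c C :: real. 0 < c \<and> c < C \<and>
    (\<forall>p q :: nat.
       c \<le> (real p + 1) powr (s + 1) * (real q + 1) powr (s + 1) * c_pq n p q s \<and>
       (real p + 1) powr (s + 1) * (real q + 1) powr (s + 1) * c_pq n p q s \<le> C)"
  unfolding c_pq_eq_c_series[OF assms] by (rule c_series_comparable[OF assms])

end
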